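(* Let $\epsilon>0$ and $\delta\in[0,1]$, and fix all inputs of the algorithm DistilDP (defined in the context) other than the private dataset $D$: the pre-trained teacher model, the pre-trained student model, the list of control codes $C$, the maximum length $T_{\max}$, the number $N$ of synthetic examples, the mixing parameter $\lambda$ and the temperature $\tau$. Then the randomized algorithm $D\mapsto S$ that, on input the private dataset $D$, runs DistilDP with privacy budget $(\epsilon,\delta)$ and outputs the student model $S$, is $(\epsilon,\delta)$-differentially private with respect to $D$.
   Context: **Differential privacy.** A dataset is a list $D=(D[1],\dots,D[n])$ of data samples, each sample being a text, i.e. a finite string of tokens from a finite vocabulary $V$. Two datasets are adjacent if they differ exactly in a single data sample (same length $n$, differing in exactly one entry). A randomized algorithm $A:\mathcal D\to\mathcal R$ is $(\epsilon,\delta)$-differentially private ($(\epsilon,\delta)$-DP) if for every pair of adjacent datasets $D,D'\in\mathcal D$ and every (measurable) set $R\subseteq\mathcal R$, $$\Pr[A(D)\in R]\le e^{\epsilon}\Pr[A(D')\in R]+\delta .$$ **Language models.** A generative language model $p$ assigns to each context (a finite token string, possibly together with a control code $c$) a probability mass function $p(\cdot\mid x_{1:s},c)$ on $V$ for the next token. The logit vector of a model $M$ on input $x$ is denoted $f_M(x)$, and $\sigma$ is the softmax function. **Control codes.** $C=(C[1],\dots,C[n])$ is a list of strings, one for each sample, containing only categorical information about the sample. The control codes are treated as non-private: they are a fixed input that does not change when $D$ is replaced by an adjacent dataset (any privacy loss coming from the distribution of control codes is ignored). **Knowledge distillation loss.** For a teacher $T$, a student $S$, a dataset $\tilde D$ of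 pairs (input $x$, true label $\mathbf y$; for text data these are contexts with their next tokens), a weight $\lambda$ and a temperature $\tau$, $$\mathcal L_{\mathrm{KD}}(T,S,\tilde D)=\sum_{(x,\mathbf y)\in\tilde D}(1-\lambda)\,\mathcal L_{\mathrm{CE}}\big(\mathbf y,\sigma(f_S(x))\big)+\lambda\tau^2\,\mathcal L_{\mathrm{KL}}\big(\log\sigma(f_T(x)/\tau),\log\sigma(f_S(x)/\tau)\big),$$ where $\mathcal L_{\mathrm{CE}}$ is the cross-entropy loss and $\mathcal L_{\mathrm{KL}}$ is the Kullback–Leibler divergence (with arguments given as log-probabilities). **Algorithm DistilDP.** Inputs: pre-trained teacher model, pre-trained student model, private dataset $D$ with $n$ samples, control codes $C$, maximum length $T_{\max}$, number $N\le n$ of synthetic examples, privacy budget $(\epsilon,\delta)$, mixing parameter $\lambda$, temperature $\tau$. 1. Preprocess: form $D'$ with $D'[i]=C[i]+D[i]$ for all $i\in\{1,\dots,n\}$, where $+$ is concatenation (the control code is prepended). 2. Fine-tune the pre-trained teacher on $D'$ using DP-SGD with privacy budget $(\epsilon,\delta)$, obtaining the fine-tuned teacher $T$. DP-SGD with privacy budget $(\epsilon,\delta)$ is a randomized training procedure that takes a dataset and outputs a model, and is $(\epsilon,\delta)$-DP with respect to the dataset it is given; this guarantee is taken as known. 3. Subsample a subset $\tilde C\subseteq C$ of the control codes with $|\tilde C|=N$ (without using $D$). 4. Start from $\tilde D=\emptyset$. For each $c\in\tilde C$, sample a synthetic example $\tilde d\sim\prod_{s=1}^{T_{\max}}T(x_s\mid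 x_{1:s-1},c)$, i.e. token by token from the fine-tuned teacher conditioned on $c$ and the previously generated tokens, and add $\tilde d$ to $\tilde D$. 5. Train the student, starting from the pre-trained student, with a non-private optimizer to minimize $S'\mapsto\mathcal L_{\mathrm{KD}}(T,S',\tilde D)$; call the result $S$. The (possibly randomized) optimizer accesses only $T$, $\tilde D$, the pre-trained student and the parameters $\lambda,\tau$, and does not access $D$. 6. Return $S$. All internal randomness used in different steps is independent. *)

theory Defs
  imports "HOL-Probability.Probability" "HOL-Library.Multiset"
begin

section \<open>Differential privacy\<close>

definition adjacent :: "'a list \<Rightarrow> 'a list \<Rightarrow> bool" where
  "adjacent D D' \<longleftrightarrow> length D = length D' \<and> card {i. i < length D \<and> D ! i \<noteq> D' ! i} = 1"

text \<open>
  A randomized algorithm is given by its output distributions: it maps every admissible dataset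
  (an element of \<open>DS\<close>) to a probability measure on the measurable space \<open>M\<close> of outputs.
\<close>

definition differentially_private ::
    "real \<Rightarrow> real \<Rightarrow> 'a list set \<Rightarrow> 'r measure \<Rightarrow> ('a list \<Rightarrow> 'r measure) \<Rightarrow> bool" where
  "differentially_private \<epsilon> \<delta> DS M A \<longleftrightarrow>
     (\<forall>D\<in>DS. A D \<in> space (prob_algebra M)) \<and>
     (\<forall>D\<in>DS. \<forall>D'\<in>DS. adjacent D D' \<longrightarrow>
        (\<forall>R\<in>sets M. measure (A D) R \<le> exp \<epsilon> * measure (A D') R + \<delta>))"


section \<open>Language models\<close>

text \<open>
  Tokens form a finite type \<open>'v\<close>; texts, contexts and control codes are lists of tokens.
  Conditioning on a control code means prepending it to the context.
\<close>

definition softmax :: "real ^ 'v \<Rightarrow> real ^ 'v::finite" where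
  "softmax z = (\<chi> v. exp (z $ v) / (\<Sum>u\<in>UNIV. exp (z $ u)))"

definition next_token :: "('v list \<Rightarrow> real ^ 'v) \<Rightarrow> 'v list \<Rightarrow> 'v::finite pmf" where
  "next_token f x = embed_pmf (\<lambda>v. softmax (f x) $ v)"

primrec sample_text :: "('v list \<Rightarrow> 'v pmf) \<Rightarrow> 'v list \<Rightarrow> nat \<Rightarrow> 'v list pmf" where
  "sample_text p ctx 0 = return_pmf []"
| "sample_text p ctx (Suc k) =
     bind_pmf (p ctx) (\<lambda>v. map_pmf ((#) v) (sample_text p (ctx @ [v]) k))"

lemma pmf_next_token: "pmf (next_token f x) v = softmax (f x) $ v"
proof -
  have pos: "0 < (\<Sum>u\<in>UNIV. exp (f x $ u))"
    by (rule sum_pos) auto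
  have "(\<Sum>v\<in>UNIV. softmax (f x) $ v) = 1"
    using pos by (simp add: softmax_def sum_divide_distrib[symmetric])
  moreover have nonneg: "0 \<le> softmax (f x) $ v" for v
    using pos by (simp add: softmax_def)
  ultimately have "(\<integral>\<^sup>+v. ennreal (softmax (f x) $ v) \<partial>count_space UNIV) = 1"
    by (simp add: nn_integral_count_space_finite)
  then show ?thesis
    unfolding next_token_def by (intro pmf_embed_pmf nonneg)
qed

lemma pmf_sample_text:
  "pmf (sample_text p ctx k) xs =
     (if length xs = k then \<Prod>s<k. pmf (p (ctx @ take s xs)) (xs ! s) else 0)"
proof (induction k arbitrary: ctx xs)
  case 0
  then show ?case by (auto simp: pmf_return)
next
  case (Suc k)
  show ?case
  proof (cases xs)
    case Nil
    have "[] \<notin> set_pmf (sample_text p ctx (Suc k))" by auto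
    then show ?thesis using Nil by (simp add: pmf_eq_0_set_pmf del: sample_text.simps)
  next
    case (Cons y ys)
    have *: "pmf (map_pmf ((#) v) (sample_text p (ctx @ [v]) k)) (y # ys) =
             indicator {y} v * pmf (sample_text p (ctx @ [y]) k) ys" for v
    proof (cases "v = y")
      case True
      have "pmf (map_pmf ((#) y) (sample_text p (ctx @ [y]) k)) ((#) y ys) =
            pmf (sample_text p (ctx @ [y]) k) ys"
        by (rule pmf_map_inj') simp
      then show ?thesis using True by simp
    next
      case False
      then have "y # ys \<notin> set_pmf (map_pmf ((#) v) (sample_text p (ctx @ [v]) k))" by auto
      then show ?thesis using False by (simp add: pmf_eq_0_set_pmf)
    qed
    have "pmf (sample_text p ctx (Suc k)) xs = pmf (p ctx) y * pmf (sample_text p (ctx @ [y]) k) ys"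
      by (simp add: Cons pmf_bind * measure_pmf_single)
    then show ?thesis
      by (simp add: Cons Suc.IH prod.lessThan_Suc_shift del: prod.lessThan_Suc)
  qed
qed


section \<open>Knowledge distillation loss\<close>

definition cross_entropy :: "real ^ 'v \<Rightarrow> real ^ 'v::finite \<Rightarrow> real" where
  "cross_entropy y q = - (\<Sum>v\<in>UNIV. y $ v * ln (q $ v))"

definition vec_ln :: "real ^ 'v \<Rightarrow> real ^ 'v::finite" where
  "vec_ln p = (\<chi> v. ln (p $ v))"

text \<open>The divergence of two distributions that are given by their log-probabilities.\<close>

definition kl_log :: "real ^ 'v \<Rightarrow> real ^ 'v::finite \<Rightarrow> real" where
  "kl_log a b = (\<Sum>v\<in>UNIV. exp (a $ v) * (a $ v - b $ v))"

definition next_token_pairs :: "'v list \<Rightarrow> ('v list \<times> 'v) multiset" where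
  "next_token_pairs d = mset (map (\<lambda>s. (take s d, d ! s)) [0..<length d])"

text \<open>
  \<open>fT\<close> and \<open>fS\<close> map the parameters of a teacher (of type \<open>'w\<close>) and of a student (of type \<open>'u\<close>) to
  their logit functions; the two architectures may differ. The true label of a context is the
  one-hot vector \<open>axis y 1\<close> of its next token \<open>y\<close>.
\<close>

definition kd_loss ::
    "('w \<Rightarrow> 'v list \<Rightarrow> real ^ 'v) \<Rightarrow> ('u \<Rightarrow> 'v list \<Rightarrow> real ^ 'v) \<Rightarrow> real \<Rightarrow> real \<Rightarrow>
     'w \<Rightarrow> 'u \<Rightarrow> 'v::finite list multiset \<Rightarrow> real" where
  "kd_loss fT fS lam \<tau> T S Dt =
     (\<Sum>(x, y)\<in>#(\<Sum>d\<in>#Dt. next_token_pairs d).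
        (1 - lam) * cross_entropy (axis y 1) (softmax (fS S x)) +
        lam * \<tau>\<^sup>2 * kl_log (vec_ln (softmax (fT T x /\<^sub>R \<tau>))) (vec_ln (softmax (fS S x /\<^sub>R \<tau>))))"


section \<open>The algorithm DistilDP\<close>

definition preprocess :: "'v list list \<Rightarrow> 'v list list \<Rightarrow> 'v list list" where
  "preprocess C D = map2 (@) C D"

text \<open>The synthetic examples, drawn independently, one for each control code.\<close>

primrec synthesize :: "('v list \<Rightarrow> 'v pmf) \<Rightarrow> nat \<Rightarrow> 'v list list \<Rightarrow> 'v list multiset pmf" where
  "synthesize p Tmax [] = return_pmf {#}"
| "synthesize p Tmax (c # cs) =
     bind_pmf (sample_text p c Tmax) (\<lambda>d. map_pmf (add_mset d) (synthesize p Tmax cs))"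

text \<open>
  A student optimizer is an arbitrary randomized procedure that is given the objective function,
  the pre-trained student, the two distillation parameters, the teacher and the synthetic data,
  and returns the distribution of the trained student.
\<close>

type_synonym ('v, 'w, 'u) optimizer =
  "('u \<Rightarrow> real) \<Rightarrow> 'u \<Rightarrow> real \<Rightarrow> real \<Rightarrow> 'w \<Rightarrow> 'v list multiset \<Rightarrow> 'u measure"

definition train_student ::
    "('v, 'w, 'u) optimizer \<Rightarrow> ('w \<Rightarrow> 'v list \<Rightarrow> real ^ 'v) \<Rightarrow> ('u \<Rightarrow> 'v list \<Rightarrow> real ^ 'v) \<Rightarrow>
     'u \<Rightarrow> real \<Rightarrow> real \<Rightarrow> 'w \<Rightarrow> 'v::finite list multiset \<Rightarrow> 'u measure" where
  "train_student opt fT fS S0 lam \<tau> T Dt =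
     opt (\<lambda>S'. kd_loss fT fS lam \<tau> T S' Dt) S0 lam \<tau> T Dt"

text \<open>
  \<open>dp_sgd T0 \<epsilon> \<delta>\<close> is the fine-tuning procedure started from the model \<open>T0\<close> with privacy budget
  \<open>(\<epsilon>, \<delta>)\<close>. As \<open>C\<close> is a list, in which categorical codes typically repeat, \<open>subsample C N\<close> is a
  distribution on sets of positions in \<open>C\<close>, and \<open>nths C I\<close> is the list of selected codes.
  The successive draws are independent because they are composed monadically.
\<close>

definition distil_dp ::
    "('w \<Rightarrow> real \<Rightarrow> real \<Rightarrow> 'v list list \<Rightarrow> 'w measure) \<Rightarrow>
     ('v list list \<Rightarrow> nat \<Rightarrow> nat set pmf) \<Rightarrow>
     ('v, 'w, 'u) optimizer \<Rightarrow>
     ('w \<Rightarrow> 'v list \<Rightarrow> real ^ 'v) \<Rightarrow> ('u \<Rightarrow> 'v list \<Rightarrow> real ^ 'v) \<Rightarrow>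
     'w \<Rightarrow> 'u \<Rightarrow> 'v list list \<Rightarrow> nat \<Rightarrow> nat \<Rightarrow> real \<Rightarrow> real \<Rightarrow> real \<Rightarrow> real \<Rightarrow>
     'v::finite list list \<Rightarrow> 'u measure" where
  "distil_dp dp_sgd subsample opt fT fS T0 S0 C Tmax N \<epsilon> \<delta> lam \<tau> D =
     Giry_Monad.bind (dp_sgd T0 \<epsilon> \<delta> (preprocess C D)) (\<lambda>T.
     Giry_Monad.bind (measure_pmf (subsample C N)) (\<lambda>I.
     Giry_Monad.bind (measure_pmf (synthesize (next_token (fT T)) Tmax (nths C I))) (\<lambda>Dt.
     train_student opt fT fS S0 lam \<tau> T Dt)))"

end

theory Submission
  imports Defs
begin

text \<open>
  The student depends on the private data only through the fine-tuned teacher, so the algorithm is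
  a Markov kernel applied to the output of DP-SGD. A kernel preserves privacy: by the layer cake
  formula, the integral of a \<open>[0, 1]\<close>-valued function against a probability measure is the average
  over \<open>t \<in> (0, 1)\<close> of the probabilities of its superlevel sets, to each of which the privacy
  inequality applies.
\<close>

section \<open>Closure properties of differential privacy\<close>

lemma nn_integral_layer_cake:
  fixes h :: "'a \<Rightarrow> real"
  assumes "sigma_finite_measure P" and h[measurable]: "h \<in> borel_measurable P"
    and le1: "\<And>x. x \<in> space P \<Longrightarrow> h x \<le> 1"
  shows "(\<integral>\<^sup>+x. ennreal (h x) \<partial>P) =
         (\<integral>\<^sup>+t. indicator {0<..<1} t * emeasure P {x \<in> space P. t < h x} \<partial>lborel)"
proof -
  interpret P: sigma_finite_measure P by fact
  interpret pair_sigma_finite P lborel ..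
  \<comment> \<open>The integrand is the indicator of the region under the graph of
    \<open>h\<close>. Cutting it off at height 1 loses nothing because of \<open>le1\<close>, and it
    confines \<open>t\<close> to a set of Lebesgue measure 1, which matters once an additive
    constant is integrated over \<open>t\<close>.\<close>
  let ?f = "\<lambda>(x, t). indicator {0<..<1} t * indicator {t. t < h x} t :: ennreal"
  have [measurable]: "?f \<in> borel_measurable (P \<Otimes>\<^sub>M lborel)"
    by (simp add: indicator_def) measurable
  have "(\<integral>\<^sup>+x. ennreal (h x) \<partial>P) = (\<integral>\<^sup>+x. (\<integral>\<^sup>+t. ?f (x, t) \<partial>lborel) \<partial>P)"
  proof (rule nn_integral_cong)
    fix x assume "x \<in> space P"
    then have eq: "?f (x, t) = indicator {0<..<h x} t" for t
      using le1[of x] by (auto simp: indicator_def)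
    show "ennreal (h x) = (\<integral>\<^sup>+t. ?f (x, t) \<partial>lborel)"
      \<comment> \<open>For negative \<open>h x\<close> both sides are 0: \<open>ennreal\<close>
        truncates on the left, and the interval is empty on the right.\<close>
      unfolding eq by (cases "0 \<le> h x") (simp_all add: ennreal_neg)
  qed
  also have "\<dots> = (\<integral>\<^sup>+t. (\<integral>\<^sup>+x. ?f (x, t) \<partial>P) \<partial>lborel)"
    by (rule Fubini'[symmetric]) simp
  also have "\<dots> = (\<integral>\<^sup>+t. indicator {0<..<1} t * emeasure P {x \<in> space P. t < h x} \<partial>lborel)"
  proof (rule nn_integral_cong)
    fix t :: real
    have "(\<integral>\<^sup>+x. ?f (x, t) \<partial>P) =
          (\<integral>\<^sup>+x. indicator {0<..<1} t * indicator {x \<in> space P. t < h x} x \<partial>P)"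
      by (rule nn_integral_cong) (auto simp: indicator_def)
    then show "(\<integral>\<^sup>+x. ?f (x, t) \<partial>P) = indicator {0<..<1} t * emeasure P {x \<in> space P. t < h x}"
      by (simp add: nn_integral_cmult)
  qed
  finally show ?thesis .
qed

lemma nn_integral_le_if_emeasure_le:
  fixes h :: "'a \<Rightarrow> real"
  assumes P: "P \<in> space (prob_algebra M)" and Q: "Q \<in> space (prob_algebra M)"
    and h: "h \<in> borel_measurable M" and le1: "\<And>x. x \<in> space M \<Longrightarrow> h x \<le> 1"
    and le: "\<And>R. R \<in> sets M \<Longrightarrow> emeasure P R \<le> c * emeasure Q R + d"
  shows "(\<integral>\<^sup>+x. ennreal (h x) \<partial>P) \<le> c * (\<integral>\<^sup>+x. ennreal (h x) \<partial>Q) + d"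
proof -
  have sets: "sets P = sets M" "sets Q = sets M" and "prob_space P" "prob_space Q"
    using P Q by (auto simp: space_prob_algebra)
  then interpret P: prob_space P + Q: prob_space Q by simp_all
  interpret pair_sigma_finite lborel Q ..
  have space: "space P = space M" "space Q = space M"
    using sets by (auto dest: sets_eq_imp_space_eq)
  have [measurable]: "h \<in> borel_measurable P" "h \<in> borel_measurable Q"
    using h by (simp_all cong: measurable_cong_sets add: sets)
  have [measurable]: "(\<lambda>t. emeasure Q {x \<in> space Q. t < h x}) \<in> borel_measurable lborel"
    by measurable
  have "(\<integral>\<^sup>+x. ennreal (h x) \<partial>P) =
        (\<integral>\<^sup>+t. indicator {0<..<1} t * emeasure P {x \<in> space P. t < h x} \<partial>lborel)"
    by (rule nn_integral_layer_cake[OF prob_space_imp_sigma_finite[OF \<open>prob_space P\<close>]]) (auto simp: le1 space)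
  \<comment> \<open>The hypothesis is applied to each superlevel set. Outside the unit interval the
    left-hand side vanishes, so \<open>d\<close> can carry the same indicator; its integral is then
    exactly \<open>d\<close>.\<close>
  also have "\<dots> \<le> (\<integral>\<^sup>+t. c * (indicator {0<..<1} t * emeasure Q {x \<in> space Q. t < h x}) +
                       d * indicator {0<..<1} t \<partial>lborel)"
  proof (rule nn_integral_mono)
    fix t :: real
    have "{x \<in> space M. t < h x} \<in> sets M" using h by measurable
    from le[OF this]
    show "indicator {0<..<1} t * emeasure P {x \<in> space P. t < h x} \<le>
          c * (indicator {0<..<1} t * emeasure Q {x \<in> space Q. t < h x}) + d * indicator {0<..<1} t"
      by (simp add: space indicator_def)
  qed
  also have "\<dots> = c * (\<integral>\<^sup>+t. indicator {0<..<1} t * emeasure Q {x \<in> space Q. t < h x} \<partial>lborel) + d"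
    by (simp add: nn_integral_add nn_integral_cmult)
  also have "(\<integral>\<^sup>+t. indicator {0<..<1} t * emeasure Q {x \<in> space Q. t < h x} \<partial>lborel) =
             (\<integral>\<^sup>+x. ennreal (h x) \<partial>Q)"
    by (rule nn_integral_layer_cake[OF prob_space_imp_sigma_finite[OF \<open>prob_space Q\<close>], symmetric]) (auto simp: le1 space)
  finally show ?thesis .
qed

text \<open>This is the post-processing property for randomized post-processing: \<open>K\<close> is
  one fixed kernel, so neighbouring datasets differ only in the measure against which it is
  integrated.\<close>

lemma differentially_private_bind:
  assumes A: "differentially_private \<epsilon> \<delta> DS M A" and "0 \<le> \<delta>"
    and K: "K \<in> M \<rightarrow>\<^sub>M prob_algebra N"
  shows "differentially_private \<epsilon> \<delta> DS N (\<lambda>D. A D \<bind> K)"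
  unfolding differentially_private_def
proof (intro conjI ballI impI)
  fix D assume "D \<in> DS"
  with A have "A D \<in> space (prob_algebra M)" by (simp add: differentially_private_def)
  then show "A D \<bind> K \<in> space (prob_algebra N)"
    using K by (simp add: space_prob_algebra[of N] prob_space_bind' sets_bind')
next
  fix D D' R assume D: "D \<in> DS" "D' \<in> DS" "adjacent D D'" and R: "R \<in> sets N"
  then have P: "A D \<in> space (prob_algebra M)" and Q: "A D' \<in> space (prob_algebra M)"
    and le: "\<And>R. R \<in> sets M \<Longrightarrow> measure (A D) R \<le> exp \<epsilon> * measure (A D') R + \<delta>"
    using A by (auto simp: differentially_private_def)
  interpret P: prob_space "A D" using P by (simp add: space_prob_algebra)
  interpret Q: prob_space "A D'" using Q by (simp add: space_prob_algebra)
  interpret PK: prob_space "A D \<bind> K" by (rule prob_space_bind'[OF P K])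
  interpret QK: prob_space "A D' \<bind> K" by (rule prob_space_bind'[OF Q K])
  \<comment> \<open>For the fixed event \<open>R\<close>, \<open>h x\<close> is the chance that
    post-processing of \<open>x\<close> lands in \<open>R\<close>; the output probability of
    \<open>R\<close> is the integral of \<open>h\<close>.\<close>
  define h where "h x = measure (K x) R" for x
  have Kx: "prob_space (K x)" if "x \<in> space M" for x
    using measurable_space[OF K that] by (simp add: space_prob_algebra)
  have h: "h \<in> borel_measurable M"
    unfolding h_def by (rule measurable_compose[OF K measurable_measure_prob_algebra[OF R]])
  have bind: "emeasure (B \<bind> K) R = (\<integral>\<^sup>+x. ennreal (h x) \<partial>B)"
    if B: "B \<in> space (prob_algebra M)" for B
  proof -
    have "space B = space M" using B by (auto simp: space_prob_algebra dest: sets_eq_imp_space_eq)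
    then show ?thesis
      unfolding emeasure_bind_prob_algebra[OF B K R] h_def
      by (intro nn_integral_cong finite_measure.emeasure_eq_measure prob_space.finite_measure Kx) simp
  qed
  \<comment> \<open>The estimate is made in \<open>ennreal\<close>, where the integrals live. It
    translates to and from the reals because \<open>exp \<epsilon>\<close>, \<open>\<delta>\<close>
    and all probabilities are nonnegative.\<close>
  have "emeasure (A D \<bind> K) R \<le> ennreal (exp \<epsilon>) * emeasure (A D' \<bind> K) R + ennreal \<delta>"
    unfolding bind[OF P] bind[OF Q]
  proof (rule nn_integral_le_if_emeasure_le[OF P Q h])
    show "h x \<le> 1" if "x \<in> space M" for x
      unfolding h_def using Kx[OF that] by (rule prob_space.prob_le_1)
    show "emeasure (A D) R \<le> ennreal (exp \<epsilon>) * emeasure (A D') R + ennreal \<delta>" if "R \<in> sets M" for R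
      using le[OF that] \<open>0 \<le> \<delta>\<close>
      by (simp add: P.emeasure_eq_measure Q.emeasure_eq_measure
          flip: ennreal_mult ennreal_plus)
  qed
  then show "measure (A D \<bind> K) R \<le> exp \<epsilon> * measure (A D' \<bind> K) R + \<delta>"
    using \<open>0 \<le> \<delta>\<close>
    by (simp add: PK.emeasure_eq_measure QK.emeasure_eq_measure
        flip: ennreal_mult ennreal_plus)
qed

text \<open>Prepending the same code to two texts preserves whether they differ, so the set of
  differing positions is unchanged. The length condition keeps \<open>map2\<close> from
  truncating.\<close>

lemma differentially_private_preprocess:
  assumes "differentially_private \<epsilon> \<delta> {D. length D = length C} M A"
  shows "differentially_private \<epsilon> \<delta> {D. length D = length C} M (\<lambda>D. A (preprocess C D))"
proof -
  have "adjacent (preprocess C D) (preprocess C D')"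
    if "length D = length C" "length D' = length C" "adjacent D D'" for D D'
  proof -
    have "{i. i < length C \<and> preprocess C D ! i \<noteq> preprocess C D' ! i} =
          {i. i < length C \<and> D ! i \<noteq> D' ! i}"
      using that by (auto simp: preprocess_def)
    then show ?thesis
      using that by (simp add: adjacent_def) (simp add: preprocess_def)
  qed
  then show ?thesis
    using assms by (simp add: differentially_private_def preprocess_def)
qed

section \<open>Measurable dependence of discrete draws on a parameter\<close>

text \<open>Written with the density \<open>pmf (p w)\<close>, the integral is taken against
  \<open>count_space S\<close>, which does not vary with \<open>w\<close>. Countability of
  \<open>S\<close> makes this measure sigma-finite, so measurability of parametrized integrals
  applies.\<close>

lemma borel_measurable_nn_integral_pmf:
  fixes g :: "'w \<Rightarrow> 'a \<Rightarrow> ennreal"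
  assumes S: "countable S" "\<And>w. w \<in> space M \<Longrightarrow> set_pmf (p w) \<subseteq> S"
    and p: "\<And>a. (\<lambda>w. pmf (p w) a) \<in> borel_measurable M"
    and g: "\<And>a. (\<lambda>w. g w a) \<in> borel_measurable M"
  shows "(\<lambda>w. \<integral>\<^sup>+a. g w a \<partial>measure_pmf (p w)) \<in> borel_measurable M"
proof -
  interpret sigma_finite_measure "count_space S"
    by (rule sigma_finite_measure_count_space_countable) fact
  have "(\<lambda>x. ennreal (pmf (p (fst x)) (snd x)) * g (fst x) (snd x))
          \<in> borel_measurable (M \<Otimes>\<^sub>M count_space S)"
    \<comment> \<open>Joint measurability reduces to measurability in \<open>w\<close> for each
      fixed \<open>a\<close>, since the second coordinate takes only countably many values.\<close>
    by (rule measurable_compose_countable'[where g = snd and I = S, OF _ measurable_snd S(1)])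
      (intro borel_measurable_times_ennreal measurable_compose[OF measurable_fst] p g
        measurable_compose[OF _ measurable_ennreal])
  then have "(\<lambda>w. \<integral>\<^sup>+a. ennreal (pmf (p w) a) * g w a \<partial>count_space S) \<in> borel_measurable M"
    by (intro borel_measurable_nn_integral) (simp add: case_prod_beta)
  also have "?this \<longleftrightarrow> ?thesis"
  proof (rule measurable_cong)
    fix w assume "w \<in> space M"
    then show "(\<integral>\<^sup>+a. ennreal (pmf (p w) a) * g w a \<partial>count_space S) =
               (\<integral>\<^sup>+a. g w a \<partial>measure_pmf (p w))"
      unfolding nn_integral_measure_pmf using S(2)[of w]
      by (intro nn_integral_count_space_eq) (auto simp: pmf_eq_0_set_pmf)
  qed
  finally show ?thesis .
qed

lemma borel_measurable_pmf_bind: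
  fixes p :: "'w \<Rightarrow> 'a::countable pmf"
  assumes "\<And>a. (\<lambda>w. pmf (p w) a) \<in> borel_measurable M"
    and "\<And>a. (\<lambda>w. pmf (q w a) b) \<in> borel_measurable M"
  shows "(\<lambda>w. pmf (bind_pmf (p w) (q w)) b) \<in> borel_measurable M"
proof -
  have "(\<lambda>w. enn2real (\<integral>\<^sup>+a. ennreal (pmf (q w a) b) \<partial>measure_pmf (p w))) \<in> borel_measurable M"
    using assms
    by (intro measurable_compose[OF _ borel_measurable_enn2real]
        borel_measurable_nn_integral_pmf[where S = UNIV]) auto
  then show ?thesis
    by (simp flip: ennreal_pmf_bind)
qed

text \<open>The common countable support \<open>S\<close> is kept explicit so that the outcome type
  may be uncountable, as \<open>nat set\<close> is for the subsampled positions.\<close>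

lemma measurable_bind_measure_pmf:
  assumes S: "countable S" "\<And>w. w \<in> space M \<Longrightarrow> set_pmf (p w) \<subseteq> S"
    and p: "\<And>a. (\<lambda>w. pmf (p w) a) \<in> borel_measurable M"
    and K: "\<And>a. (\<lambda>w. K w a) \<in> M \<rightarrow>\<^sub>M prob_algebra N"
  shows "(\<lambda>w. measure_pmf (p w) \<bind> K w) \<in> M \<rightarrow>\<^sub>M prob_algebra N"
proof -
  have pmf: "measure_pmf (p w) \<in> space (prob_algebra (count_space UNIV))" for w
    by (simp add: space_prob_algebra prob_space_measure_pmf)
  have Kw: "K w \<in> count_space UNIV \<rightarrow>\<^sub>M prob_algebra N" if "w \<in> space M" for w
    using measurable_space[OF K that] by simp
  have prob: "prob_space (measure_pmf (p w) \<bind> K w)" if "w \<in> space M" for w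
    by (rule prob_space_bind'[OF pmf Kw[OF that]])
  \<comment> \<open>Measurability into \<open>subprob_algebra N\<close> can be tested on the mass of
    each event \<open>R\<close>; restricting to probability measures afterwards gives the
    claim.\<close>
  have "(\<lambda>w. measure_pmf (p w) \<bind> K w) \<in> M \<rightarrow>\<^sub>M subprob_algebra N"
  proof (rule measurable_subprob_algebra)
    fix w assume w: "w \<in> space M"
    show "subprob_space (measure_pmf (p w) \<bind> K w)"
      by (rule prob_space_imp_subprob_space[OF prob[OF w]])
    show "sets (measure_pmf (p w) \<bind> K w) = sets N"
      by (rule sets_bind'[OF pmf Kw[OF w]])
  next
    fix R assume R: "R \<in> sets N"
    have "(\<lambda>w. \<integral>\<^sup>+a. emeasure (K w a) R \<partial>measure_pmf (p w)) \<in> borel_measurable M"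
      by (intro borel_measurable_nn_integral_pmf[OF S p] measurable_emeasure_kernel[OF _ R]
          measurable_prob_algebraD K)
    then show "(\<lambda>w. emeasure (measure_pmf (p w) \<bind> K w) R) \<in> borel_measurable M"
      by (subst measurable_cong[OF emeasure_bind_prob_algebra[OF pmf Kw R]])
  qed
  then show ?thesis
    by (auto simp: prob_algebra_def intro!: measurable_restrict_space2 prob)
qed

section \<open>Sampling from the teacher as a function of its parameters\<close>

lemma borel_measurable_pmf_next_token:
  assumes [measurable]: "(\<lambda>w. f w x) \<in> borel_measurable M"
  shows "(\<lambda>w. pmf (next_token (f w) x) v) \<in> borel_measurable M"
proof -
  have [measurable]: "(\<lambda>w. f w x $ u) \<in> borel_measurable M" for u
    by (rule measurable_compose[OF assms]) (intro borel_measurable_continuous_onI continuous_intros)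
  show ?thesis
    by (simp add: pmf_next_token softmax_def)
qed

text \<open>The closed formula \<open>pmf_sample_text\<close> is a finite product of next-token
  probabilities, or constantly 0.\<close>

lemma borel_measurable_pmf_sample_text:
  fixes p :: "'w \<Rightarrow> 'v::finite list \<Rightarrow> 'v pmf"
  assumes "\<And>x v. (\<lambda>w. pmf (p w x) v) \<in> borel_measurable M"
  shows "(\<lambda>w. pmf (sample_text (p w) ctx k) xs) \<in> borel_measurable M"
  using assms by (cases "length xs = k") (simp_all add: pmf_sample_text)

lemma borel_measurable_pmf_synthesize:
  fixes p :: "'w \<Rightarrow> 'v::finite list \<Rightarrow> 'v pmf"
  assumes p: "\<And>x v. (\<lambda>w. pmf (p w x) v) \<in> borel_measurable M"
  shows "(\<lambda>w. pmf (synthesize (p w) k cs) X) \<in> borel_measurable M"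
proof (induction cs arbitrary: X)
  case Nil
  then show ?case by simp
next
  case (Cons c cs)
  have "(\<lambda>w. pmf (map_pmf (add_mset d) (synthesize (p w) k cs)) X) \<in> borel_measurable M" for d
  \<comment> \<open>As \<open>add_mset d\<close> is injective, \<open>X\<close> has at most one
    preimage, which exists exactly when \<open>d\<close> occurs in \<open>X\<close>.\<close>
  proof (cases "d \<in># X")
    case True
    then obtain Y where Y: "X = add_mset d Y" by (metis insert_DiffM)
    have "pmf (map_pmf (add_mset d) q) X = pmf q Y" for q
      unfolding Y by (rule pmf_map_inj') (simp add: inj_def)
    then show ?thesis by (simp add: Cons.IH)
  next
    case False
    then have "pmf (map_pmf (add_mset d) q) X = 0" for q
      by (auto simp: pmf_eq_0_set_pmf)
    then show ?thesis by simp
  qed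
  then show ?case
    by (simp add: borel_measurable_pmf_bind borel_measurable_pmf_sample_text p)
qed

lemma countable_UNIV_multiset: "countable (UNIV :: 'a::countable multiset set)"
  using countable_image[OF countableI_type, of mset UNIV] by (simp add: surj_mset)

section \<open>Privacy of DistilDP\<close>

theorem theorem4p1:
  fixes \<epsilon> \<delta> lam \<tau> :: real
    and n N Tmax :: nat
    and MT :: "'w measure" and MS :: "'u measure"
    and fT :: "'w \<Rightarrow> 'v::finite list \<Rightarrow> real ^ 'v"
    and fS :: "'u \<Rightarrow> 'v list \<Rightarrow> real ^ 'v"
    and T0 :: 'w and S0 :: 'u
    and C :: "'v list list"
    and dp_sgd :: "'w \<Rightarrow> real \<Rightarrow> real \<Rightarrow> 'v list list \<Rightarrow> 'w measure"
    and subsample :: "'v list list \<Rightarrow> nat \<Rightarrow> nat set pmf"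
    and opt :: "('v, 'w, 'u) optimizer"
  assumes "\<epsilon> > 0" and "0 \<le> \<delta>" and "\<delta> \<le> 1"
    and "length C = n" and "N \<le> n"
    and "T0 \<in> space MT" and "S0 \<in> space MS"
    and teacher_measurable: "\<And>x. (\<lambda>T. fT T x) \<in> borel_measurable MT"
    and dp_sgd_private: "differentially_private \<epsilon> \<delta> {D. length D = n} MT (dp_sgd T0 \<epsilon> \<delta>)"
    and subsample_size: "set_pmf (subsample C N) \<subseteq> {I. I \<subseteq> {..<n} \<and> card I = N}"
    and optimizer_randomized:
      "\<And>Dt. (\<lambda>T. train_student opt fT fS S0 lam \<tau> T Dt) \<in> MT \<rightarrow>\<^sub>M prob_algebra MS"
  shows "differentially_private \<epsilon> \<delta> {D. length D = n} MS
           (distil_dp dp_sgd subsample opt fT fS T0 S0 C Tmax N \<epsilon> \<delta> lam \<tau>)"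
proof -
  \<comment> \<open>Everything after fine-tuning is a Markov kernel in \<open>T\<close>. For the
    draw of positions, \<open>S\<close> is the support of \<open>subsample C N\<close>, which does
    not depend on \<open>T\<close>; for the synthetic data it is the countable set of all multisets
    of texts.\<close>
  have "(\<lambda>T. measure_pmf (subsample C N) \<bind> (\<lambda>I.
          measure_pmf (synthesize (next_token (fT T)) Tmax (nths C I)) \<bind> (\<lambda>Dt.
          train_student opt fT fS S0 lam \<tau> T Dt))) \<in> MT \<rightarrow>\<^sub>M prob_algebra MS"
    by (intro measurable_bind_measure_pmf[OF countable_set_pmf[of "subsample C N"]]
        measurable_bind_measure_pmf[OF countable_UNIV_multiset] borel_measurable_pmf_synthesize
        borel_measurable_pmf_next_token teacher_measurable optimizer_randomized) simp_all
  moreover have "differentially_private \<epsilon> \<delta> {D. length D = n} MT (\<lambda>D. dp_sgd T0 \<epsilon> \<delta> (preprocess C D))"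
    using differentially_private_preprocess[of \<epsilon> \<delta> C] dp_sgd_private \<open>length C = n\<close> by simp
  ultimately show ?thesis
    unfolding distil_dp_def using \<open>0 \<le> \<delta>\<close> by (intro differentially_private_bind)
qed

end
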